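(* Let $y_1,\dots,y_M\in\mathbb{R}^n$ be fixed, let $\Gamma\in\mathbb{R}_+^{N\times M}$ be a fixed coupling matrix with $\sum_{k=1}^M\Gamma_{ik}>0$ for every $i$, let $\varepsilon>0$, and let $c(z,y)=\|z-y\|_2^2$ for $z,y\in\mathbb{R}^n$. Then the minimizer over $\mathbf{z}=(z_1,\dots,z_N)\in(\mathbb{R}^n)^N$ of the function $$\mathbf{z}\mapsto \mathcal{L}^c_\varepsilon(\mathbf{z},\Gamma;\mathbf{y})=\sum_{i=1}^N\sum_{j=1}^M c(z_i,y_j)\,\Gamma_{ij}-\varepsilon H(\Gamma)$$ is the barycentric projection $\mathbf{z}^\star=(z_1^\star,\dots,z_N^\star)$ given by $$z_i^\star=\frac{\sum_{j=1}^M\Gamma_{ij}\,y_j}{\sum_{k=1}^M\Gamma_{ik}},\qquad i=1,\dots,N.$$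
   Context: $\mathbf{y}=(y_1,\dots,y_M)$ is the tuple of proposals and $\mathbf{z}=(z_1,\dots,z_N)$ the tuple of particles. The entropy of a nonnegative matrix is $H(\Gamma)=-\sum_{i,j}\Gamma_{ij}(\log\Gamma_{ij}-1)$, with the convention $0\log 0=0$. *)

theory Defs
  imports "HOL-Analysis.Analysis"
begin

text \<open>
  Matrices with \<open>N\<close> rows and \<open>M\<close> columns have type \<open>real ^ 'm ^ 'n\<close> with
  \<open>CARD('n) = N\<close> and \<open>CARD('m) = M\<close>; tuples of points of Euclidean space \<open>real ^ 'd\<close> have
  type \<open>(real ^ 'd) ^ 'n\<close> (particles) and \<open>(real ^ 'd) ^ 'm\<close> (proposals).
\<close>

text \<open>
  The convention \<open>0 log 0 = 0\<close> needs no case distinction: \<open>ln\<close> is total, so a zero entry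
  contributes \<open>0 * (ln 0 - 1) = 0\<close>.
\<close>

definition matrix_entropy :: "real ^ 'm ^ 'n \<Rightarrow> real" where
  "matrix_entropy \<Gamma> = - (\<Sum>i\<in>UNIV. \<Sum>j\<in>UNIV. \<Gamma> $ i $ j * (ln (\<Gamma> $ i $ j) - 1))"

definition sq_dist_cost :: "real ^ 'd \<Rightarrow> real ^ 'd \<Rightarrow> real" where
  "sq_dist_cost z y = (norm (z - y))\<^sup>2"

definition entropic_loss ::
  "(real ^ 'd \<Rightarrow> real ^ 'd \<Rightarrow> real) \<Rightarrow> real \<Rightarrow>
   (real ^ 'd) ^ 'n \<Rightarrow> real ^ 'm ^ 'n \<Rightarrow> (real ^ 'd) ^ 'm \<Rightarrow> real" where
  "entropic_loss c \<epsilon> z \<Gamma> y =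
     (\<Sum>i\<in>UNIV. \<Sum>j\<in>UNIV. c (z $ i) (y $ j) * \<Gamma> $ i $ j) - \<epsilon> * matrix_entropy \<Gamma>"

definition barycentric_projection ::
  "real ^ 'm ^ 'n \<Rightarrow> (real ^ 'd) ^ 'm \<Rightarrow> (real ^ 'd) ^ 'n" where
  "barycentric_projection \<Gamma> y =
     (\<chi> i. (\<Sum>j\<in>UNIV. \<Gamma> $ i $ j *\<^sub>R y $ j) /\<^sub>R (\<Sum>k\<in>UNIV. \<Gamma> $ i $ k))"

end

theory Submission
  imports Defs
begin

text \<open>
  Completing the square row by row (Huygens--Steiner) shows that the loss at \<open>z\<close> exceeds the loss
  at the barycentric projection by \<open>\<Sum>i. (\<Sum>k. \<Gamma> $ i $ k) * (norm (z $ i - b $ i))\<^sup>2\<close>, where \<open>b\<close> is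
  that projection. All row sums are positive, so this excess vanishes only at \<open>z = b\<close>.
\<close>

text \<open>Splitting \<open>z - y j\<close> as \<open>(z - b) + (b - y j)\<close> leaves a cross
  term linear in \<open>b - y j\<close>, whose weighted sum vanishes at a barycenter. The barycenter
  condition is stated with its denominator cleared.\<close>

lemma sum_sq_dist_barycenter:
  fixes y :: "'a \<Rightarrow> 'b::real_inner" and w :: "'a \<Rightarrow> real"
  assumes "sum w S *\<^sub>R b = (\<Sum>j\<in>S. w j *\<^sub>R y j)"
  shows "(\<Sum>j\<in>S. (norm (z - y j))\<^sup>2 * w j) =
    (\<Sum>j\<in>S. (norm (b - y j))\<^sup>2 * w j) + sum w S * (norm (z - b))\<^sup>2"
proof -
  \<comment> \<open>The weight sits inside the inner product so that the sum over \<open>j\<close>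
    can be moved into its second argument.\<close>
  have sq: "(norm (z - y j))\<^sup>2 * w j =
      (norm (b - y j))\<^sup>2 * w j + w j * (norm (z - b))\<^sup>2 + 2 * ((z - b) \<bullet> (w j *\<^sub>R b - w j *\<^sub>R y j))" for j
    by (simp add: power2_norm_eq_inner inner_diff_left inner_diff_right inner_commute algebra_simps)
  have "(\<Sum>j\<in>S. w j *\<^sub>R b - w j *\<^sub>R y j) = 0"
    using assms by (simp only: sum_subtractf diff_self flip: scaleR_sum_left)
  then have "(\<Sum>j\<in>S. 2 * ((z - b) \<bullet> (w j *\<^sub>R b - w j *\<^sub>R y j))) = 0"
    by (simp only: inner_zero_right mult_zero_right flip: sum_distrib_left inner_sum_right)
  then show ?thesis
    unfolding sq by (simp only: sum.distrib sum_distrib_right add_0_right)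
qed

text \<open>The entropy term is independent of \<open>z\<close> and cancels; the rest is the
  preceding identity in each row, with that row of \<open>\<Gamma>\<close> as weights.\<close>

lemma entropic_loss_eq_barycentric_projection:
  fixes y :: "(real ^ 'd) ^ 'm" and \<Gamma> :: "real ^ 'm ^ 'n"
  assumes "\<And>i. (\<Sum>k\<in>UNIV. \<Gamma> $ i $ k) \<noteq> 0"
  shows "entropic_loss sq_dist_cost \<epsilon> z \<Gamma> y =
    entropic_loss sq_dist_cost \<epsilon> (barycentric_projection \<Gamma> y) \<Gamma> y +
    (\<Sum>i\<in>UNIV. (\<Sum>k\<in>UNIV. \<Gamma> $ i $ k) * (norm (z $ i - barycentric_projection \<Gamma> y $ i))\<^sup>2)"
proof -
  have "(\<Sum>k\<in>UNIV. \<Gamma> $ i $ k) *\<^sub>R (barycentric_projection \<Gamma> y $ i) = (\<Sum>j\<in>UNIV. \<Gamma> $ i $ j *\<^sub>R y $ j)" for i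
    using assms[of i] by (simp add: barycentric_projection_def)
  then show ?thesis
    unfolding entropic_loss_def sq_dist_cost_def
    by (simp add: sum_sq_dist_barycenter[where z = "z $ i" and b = "barycentric_projection \<Gamma> y $ i" for i]
        sum.distrib)
qed

theorem proposition1:
  fixes y :: "(real ^ 'd) ^ 'm"
    and \<Gamma> :: "real ^ 'm ^ 'n"
    and \<epsilon> :: real
  assumes "\<And>i j. \<Gamma> $ i $ j \<ge> 0"
    and "\<And>i. (\<Sum>k\<in>UNIV. \<Gamma> $ i $ k) > 0"
    and "\<epsilon> > 0"
  shows "\<forall>z :: (real ^ 'd) ^ 'n.
    is_arg_min (\<lambda>z. entropic_loss sq_dist_cost \<epsilon> z \<Gamma> y) (\<lambda>_. True) z \<longleftrightarrow>
    z = barycentric_projection \<Gamma> y"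
proof
  fix z :: "(real ^ 'd) ^ 'n"
  define b where "b = barycentric_projection \<Gamma> y"
  define L where "L z = entropic_loss sq_dist_cost \<epsilon> z \<Gamma> y" for z :: "(real ^ 'd) ^ 'n"
  define g where "g z i = (\<Sum>k\<in>UNIV. \<Gamma> $ i $ k) * (norm (z $ i - b $ i))\<^sup>2"
    for z :: "(real ^ 'd) ^ 'n" and i
  have row: "(\<Sum>k\<in>UNIV. \<Gamma> $ i $ k) \<noteq> 0" for i
    using assms(2)[of i] by simp
  have L: "L z = L b + (\<Sum>i\<in>UNIV. g z i)" for z
    unfolding L_def g_def b_def by (rule entropic_loss_eq_barycentric_projection[OF row])
  have g_nonneg: "g z i \<ge> 0" for z i
    using assms(2)[of i] by (simp add: g_def)
  have "L b \<le> L z" for z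
    by (simp add: L[of z] sum_nonneg g_nonneg)
  \<comment> \<open>This gives uniqueness: a minimizer satisfies the premise, by comparison with
    \<open>b\<close>.\<close>
  moreover have "z = b" if "L z \<le> L b"
  proof -
    have "(\<Sum>i\<in>UNIV. g z i) = 0"
      using that L[of z] sum_nonneg[of UNIV "g z", OF g_nonneg] by linarith
    then have "g z i = 0" for i
      by (simp add: sum_nonneg_eq_0_iff g_nonneg)
    \<comment> \<open>A positive row sum forces the norm factor of \<open>g z i\<close> to vanish,
      hence \<open>z $ i = b $ i\<close> in every row.\<close>
    then show ?thesis
      using row by (simp add: g_def vec_eq_iff)
  qed
  ultimately have "is_arg_min L (\<lambda>_. True) z \<longleftrightarrow> z = b"
    by (auto simp: is_arg_min_def not_less)
  then show "is_arg_min (\<lambda>z. entropic_loss sq_dist_cost \<epsilon> z \<Gamma> y) (\<lambda>_. True) z \<longleftrightarrow>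
    z = barycentric_projection \<Gamma> y"
    by (simp add: L_def[abs_def] b_def)
qed

end
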